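(* Let $X$ be a nonempty standard Borel space, let $n \geq 1$, let $L_1,\dots,L_n : X \to \mathbb R$ be Borel measurable, and put $L(x) = (L_1(x),\dots,L_n(x))$ and $S = L(X) \subseteq \mathbb R^n$. Let $U : \mathbb R^n \to \mathbb R$ be continuous and strictly increasing, and let $f : X \to \mathbb R$ be $f(x) = U(L(x))$. Suppose $S$ is bounded, and let $\eta$ be a real number with $\inf_{y \in X} f(y) \leq \eta < \sup_{y\in X} f(y)$. Let $\Xi = \{s \in \operatorname{cl}(S) : \forall r \in \operatorname{cl}(S),\ s \not\prec r\}$. There is an $\eta$-catastrophic tradeoff proxy for $f$ if and only if there exists $s^* \in \Xi$ such that $U(s^* ) \leq \eta$.
   Context: Strictly increasing: a function $\mathbb R^n \to \mathbb R$ is strictly increasing when it is strictly increasing in each coordinate (with the other coordinates held fixed). Order: for $s,r \in \mathbb R^n$, $s \preceq r$ means $s_i \leq r_i$ for all $1\le i\le n$; $s \prec r$ means $s \preceq r$ and $s \neq r$. $\operatorname{cl}(S)$ is the closure of $S$ in $\mathbb R^n$. Tradeoff proxy: $g : X \to \mathbb R$ is a tradeoff proxy for $f = U\circ L$ when there is a continuous strictly increasing $V : \mathbb R^n \to \mathbb R$ with $g(x) = V(L(x))$ for all $x \in X$. Optimizer: let $\mathcal M(X)$ be the set of bounded Borel measurable functions $X \to \mathbb R$ and $\Delta(X)$ the set of Borel probability measures on $X$. An optimizer is a map $\Omega : \mathbb R_{\geq 0} \times \mathcal M(X) \times \Delta(X) \to \Delta(X)$, written $(k,g,p) \mapsto \Omega_k(g,p)$,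 such that for all $g \in \mathcal M(X)$ and $p \in \Delta(X)$: (1) $\Omega_0(g,p) = p$; (2) $j<k$ implies $\mathbb E_{x\sim\Omega_j(g,p)}[g(x)] \leq \mathbb E_{x\sim\Omega_k(g,p)}[g(x)]$; (3) for all $M < \sup_{y\in X} g(y)$, $\lim_{k\to\infty} \Pr_{x\sim\Omega_k(g,p)}[g(x) > M] = 1$; (4) $\lim_{k\to\infty} \mathbb E_{x\sim\Omega_k(g,p)}[g(x)] = \sup_{y\in X} g(y)$. $\eta$-catastrophic: for a real number $\eta$ with $\inf_{y\in X} f(y) \leq \eta < \sup_{y\in X} f(y)$, a value function $g$ is $\eta$-catastrophic for $f$ when for all initial priors $p \in \Delta(X)$ and all optimizers $\Omega$, $\limsup_{k\to\infty} \mathbb E_{x\sim\Omega_k(g,p)}[f(x)] \leq \eta$. (Since $S$ is bounded, $f$ and all tradeoff proxies are bounded.) *)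

theory Defs
  imports "HOL-Probability.Probability"
begin

text \<open>
  A measurable space \<open>X\<close> is given by a value \<open>M :: 'a measure\<close>, of which only
  \<open>space M\<close> and \<open>sets M\<close> are used. \<open>\<Delta>(X)\<close> is \<open>space (prob_algebra M)\<close>, the set of
  probability measures on \<open>sets M\<close>. Functions \<open>X \<rightarrow> \<real>\<close> that serve as
  arguments of an optimizer are extensional on \<open>space M\<close>, so that equality in HOL is
  equality as functions on \<open>X\<close>.
\<close>

definition standard_borel_space :: "'a measure \<Rightarrow> bool" where
  "standard_borel_space M \<longleftrightarrow>
     (\<exists>T. completely_metrizable_space T \<and> separable_space T \<and>
          space M = topspace T \<and> sets M = sigma_sets (topspace T) {A. openin T A})"

text \<open>Strictly increasing in each coordinate, the other coordinates being held fixed.\<close>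

definition strictly_increasing :: "(real ^ 'n \<Rightarrow> real) \<Rightarrow> bool" where
  "strictly_increasing V \<longleftrightarrow>
     (\<forall>x i. strict_mono (\<lambda>t. V (\<chi> j. if j = i then t else x $ j)))"

definition bounded_measurable :: "'a measure \<Rightarrow> ('a \<Rightarrow> real) set" where
  "bounded_measurable M =
     {g. g \<in> borel_measurable M \<and> bounded (g ` space M) \<and> g \<in> extensional (space M)}"

definition tradeoff_proxy ::
    "'a measure \<Rightarrow> ('a \<Rightarrow> real ^ 'n) \<Rightarrow> ('a \<Rightarrow> real) \<Rightarrow> bool" where
  "tradeoff_proxy M L g \<longleftrightarrow> g \<in> extensional (space M) \<and>
     (\<exists>V. continuous_on UNIV V \<and> strictly_increasing V \<and> (\<forall>x\<in>space M. g x = V (L x)))"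

text \<open>The values of \<open>\<Omega>\<close> outside \<open>{0..} \<times> bounded_measurable M \<times> \<Delta>(X)\<close> are irrelevant.\<close>

definition optimizer ::
    "'a measure \<Rightarrow> (real \<Rightarrow> ('a \<Rightarrow> real) \<Rightarrow> 'a measure \<Rightarrow> 'a measure) \<Rightarrow> bool" where
  "optimizer M \<Omega> \<longleftrightarrow>
     (\<forall>g\<in>bounded_measurable M. \<forall>p\<in>space (prob_algebra M).
        (\<forall>k\<ge>0. \<Omega> k g p \<in> space (prob_algebra M)) \<and>
        \<Omega> 0 g p = p \<and>
        (\<forall>j k. 0 \<le> j \<and> j < k \<longrightarrow> (\<integral>x. g x \<partial>\<Omega> j g p) \<le> (\<integral>x. g x \<partial>\<Omega> k g p)) \<and>
        (\<forall>m. m < (SUP y\<in>space M. g y) \<longrightarrow>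
           ((\<lambda>k. measure (\<Omega> k g p) {x \<in> space M. g x > m}) \<longlongrightarrow> 1) at_top) \<and>
        ((\<lambda>k. \<integral>x. g x \<partial>\<Omega> k g p) \<longlongrightarrow> (SUP y\<in>space M. g y)) at_top)"

text \<open>The upper limit is taken in \<open>ereal\<close>, which is a complete lattice.\<close>

definition catastrophic ::
    "'a measure \<Rightarrow> ('a \<Rightarrow> real) \<Rightarrow> real \<Rightarrow> ('a \<Rightarrow> real) \<Rightarrow> bool" where
  "catastrophic M f \<eta> g \<longleftrightarrow> g \<in> bounded_measurable M \<and>
     (\<forall>p\<in>space (prob_algebra M). \<forall>\<Omega>. optimizer M \<Omega> \<longrightarrow>
        Limsup at_top (\<lambda>k::real. ereal (\<integral>x. f x \<partial>\<Omega> k g p)) \<le> ereal \<eta>)"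

text \<open>
  On \<open>real ^ 'n\<close> the library order \<open>s \<le> r\<close> is componentwise, and \<open>s < r\<close> means
  \<open>s \<le> r \<and> s \<noteq> r\<close>.
\<close>

definition undominated :: "(real ^ 'n) set \<Rightarrow> (real ^ 'n) set" where
  "undominated S = {s \<in> closure S. \<forall>r\<in>closure S. \<not> s < r}"

end

theory Submission
  imports Defs
begin

text \<open>
  If \<open>s\<close> is undominated in the compact set \<open>K = closure S\<close>, every other point of \<open>K\<close> falls short
  of \<open>s\<close> in some coordinate, and by compactness its total excess over \<open>s\<close> is controlled by its
  total shortfall. A proxy that rewards excess slowly enough compared with its penalty for shortfall
  therefore has \<open>s\<close> as its only maximizer on \<open>K\<close>, so optimizing it drives \<open>L\<close> towards
  \<open>s\<close> and the expected true value to at most \<open>U s\<close>.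

  Conversely, a maximizer on \<open>K\<close> of any strictly increasing \<open>V\<close> is undominated. If \<open>U\<close> exceeds
  \<open>\<eta>\<close> there, points of \<open>X\<close> near this maximizer give a sequence along which the proxy
  increases to its supremum while \<open>f\<close> stays above a constant larger than \<open>\<eta>\<close>; an optimizer
  that outputs point masses along this sequence shows that the proxy is not catastrophic.
\<close>

section \<open>Strictly increasing functions and the componentwise order\<close>

lemma strictly_increasing_update:
  assumes "strictly_increasing V" "(x :: real ^ 'n::finite) $ i < t"
  shows "V x < V (\<chi> j. if j = i then t else x $ j)"
proof -
  have "strict_mono (\<lambda>t. V (\<chi> j. if j = i then t else x $ j))"
    using assms(1) by (auto simp: strictly_increasing_def)
  from strict_monoD[OF this assms(2)]
  have "V (\<chi> j. if j = i then x $ i else x $ j) < V (\<chi> j. if j = i then t else x $ j)" .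
  moreover have "(\<chi> j. if j = i then x $ i else x $ j) = x"
    by (auto simp: vec_eq_iff)
  ultimately show ?thesis by simp
qed

text \<open>The passage from \<open>s\<close> to \<open>r\<close> raises one coordinate at a time;
  the induction runs over the set \<open>A\<close> of coordinates already replaced.\<close>

lemma strictly_increasing_mono:
  assumes V: "strictly_increasing V" and le: "(s :: real ^ 'n::finite) \<le> r"
  shows "V s \<le> V r"
proof -
  have "V s \<le> V (\<chi> j. if j \<in> A then r $ j else s $ j)" if "finite A" for A
    using that
  proof (induction A)
    case empty
    have "(\<chi> j. if j \<in> {} then r $ j else s $ j) = s"
      by (auto simp: vec_eq_iff)
    then show ?case by simp
  next
    case (insert i A)
    let ?x = "\<chi> j. if j \<in> A then r $ j else s $ j"
    have eq: "(\<chi> j. if j \<in> insert i A then r $ j else s $ j)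
        = (\<chi> j. if j = i then r $ i else ?x $ j)"
      by (auto simp: vec_eq_iff)
    have xi: "?x $ i = s $ i" using insert by simp
    show ?case
    proof (cases "s $ i = r $ i")
      case True
      then have "(\<chi> j. if j = i then r $ i else ?x $ j) = ?x"
        using xi by (auto simp: vec_eq_iff)
      then show ?thesis unfolding eq using insert.IH by simp
    next
      case False
      then have "?x $ i < r $ i" using xi le by (simp add: less_eq_vec_def less_le)
      from strictly_increasing_update[OF V this] show ?thesis
        unfolding eq using insert.IH by linarith
    qed
  qed
  from this[of UNIV] show ?thesis by simp
qed

text \<open>One coordinate \<open>i\<close> with \<open>s $ i < r $ i\<close> is raised first and
  gives the strict gain; the others only need weak monotonicity.\<close>

lemma strictly_increasing_strict_mono:
  assumes V: "strictly_increasing V" and less: "(s :: real ^ 'n::finite) < r"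
  shows "V s < V r"
proof -
  have le: "s \<le> r" and ne: "s \<noteq> r" using less by auto
  then obtain i where i: "s $ i < r $ i"
    by (metis less_eq_vec_def order_le_less vec_eq_iff)
  have "(\<chi> j. if j = i then r $ i else s $ j) \<le> r"
    using le by (simp add: less_eq_vec_def)
  from strictly_increasing_mono[OF V this] strictly_increasing_update[OF V i]
  show ?thesis by linarith
qed

section \<open>A strictly increasing function with a prescribed unique maximizer\<close>

definition shortfall :: "real ^ 'n::finite \<Rightarrow> real ^ 'n \<Rightarrow> real" where
  "shortfall s x = (\<Sum>i\<in>UNIV. max 0 (s $ i - x $ i))"

text \<open>Shortfall and excess are the l1 norms of the negative and positive parts of
  \<open>x - s\<close>; swapping arguments lets each fact serve both.\<close>

abbreviation (input) excess :: "real ^ 'n::finite \<Rightarrow> real ^ 'n \<Rightarrow> real" where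
  "excess s x \<equiv> shortfall x s"

lemma shortfall_nonneg: "0 \<le> shortfall s x"
  by (simp add: shortfall_def sum_nonneg)

lemma shortfall_self [simp]: "shortfall s s = 0"
  by (simp add: shortfall_def)

lemma shortfall_eq_0_iff: "shortfall s x = 0 \<longleftrightarrow> s \<le> x"
  by (simp add: shortfall_def less_eq_vec_def sum_nonneg_eq_0_iff max.absorb_iff1[symmetric])

lemma continuous_on_shortfall [continuous_intros]:
  assumes "continuous_on A f" "continuous_on A g"
  shows "continuous_on A (\<lambda>x. shortfall (f x) (g x))"
  unfolding shortfall_def by (intro continuous_intros assms)

text \<open>Taking \<open>q = excess s r\<close> in the infimum shows that for \<open>r \<in> K\<close> the gauge of the excess is
  at most the shortfall.\<close>

definition gauge_fun :: "(real ^ 'n::finite) set \<Rightarrow> real ^ 'n \<Rightarrow> real \<Rightarrow> real" where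
  "gauge_fun K s q = (INF r\<in>K. shortfall s r + max 0 (q - excess s r))"

lemma gauge_fun_le:
  assumes "r \<in> K"
  shows "gauge_fun K s q \<le> shortfall s r + max 0 (q - excess s r)"
  unfolding gauge_fun_def
  by (rule cINF_lower[OF _ assms], rule bdd_belowI2[where m = 0]) (simp add: shortfall_nonneg)

lemma gauge_fun_mono:
  assumes "K \<noteq> {}" "a \<le> b"
  shows "gauge_fun K s a \<le> gauge_fun K s b"
  unfolding gauge_fun_def[of _ _ b]
proof (rule cINF_greatest[OF assms(1)])
  fix r assume "r \<in> K"
  from gauge_fun_le[OF this, of s a] assms(2)
  show "gauge_fun K s a \<le> shortfall s r + max 0 (b - excess s r)" by linarith
qed

text \<open>Each function in the infimum is 1-Lipschitz in \<open>q\<close>, uniformly in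
  \<open>r\<close>, and the infimum inherits this.\<close>

lemma gauge_fun_lipschitz:
  assumes "K \<noteq> {}"
  shows "gauge_fun K s a \<le> gauge_fun K s b + \<bar>a - b\<bar>"
proof -
  have "gauge_fun K s a - \<bar>a - b\<bar> \<le> gauge_fun K s b"
    unfolding gauge_fun_def[of _ _ b]
  proof (rule cINF_greatest[OF assms(1)])
    fix r assume "r \<in> K"
    from gauge_fun_le[OF this, of s a]
    show "gauge_fun K s a - \<bar>a - b\<bar> \<le> shortfall s r + max 0 (b - excess s r)" by linarith
  qed
  then show ?thesis by linarith
qed

lemma continuous_on_gauge_fun:
  assumes "K \<noteq> {}"
  shows "continuous_on UNIV (gauge_fun K s)"
proof -
  have "dist (gauge_fun K s a) (gauge_fun K s b) \<le> dist a b" for a b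
    using gauge_fun_lipschitz[OF assms, of s a b] gauge_fun_lipschitz[OF assms, of s b a]
    unfolding dist_real_def by linarith
  then show ?thesis
    unfolding continuous_on_iff by (metis order_le_less_trans)
qed

lemma gauge_fun_nonneg:
  assumes "K \<noteq> {}"
  shows "0 \<le> gauge_fun K s q"
  unfolding gauge_fun_def by (rule cINF_greatest[OF assms]) (simp add: shortfall_nonneg)

text \<open>By compactness the infimum is attained. Value 0 would mean no shortfall at the
  minimizer, hence \<open>r = s\<close>; but there the excess is 0 and the second term is
  \<open>q\<close>.\<close>

lemma gauge_fun_pos:
  assumes "compact K" "s \<in> K" and undom: "\<And>r. r \<in> K \<Longrightarrow> \<not> s < r" and "0 < q"
  shows "0 < gauge_fun K s q"
proof -
  let ?h = "\<lambda>r. shortfall s r + max 0 (q - excess s r)"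
  have ne: "K \<noteq> {}" using assms by auto
  obtain r where r: "r \<in> K" "\<And>y. y \<in> K \<Longrightarrow> ?h r \<le> ?h y"
  proof -
    have "continuous_on K ?h" by (intro continuous_intros)
    from continuous_attains_inf[OF assms(1) ne this] that show thesis by blast
  qed
  have "?h r \<noteq> 0"
  proof
    assume 0: "?h r = 0"
    then have "shortfall s r = 0" using shortfall_nonneg[of s r] by linarith
    then have "s \<le> r" by (simp add: shortfall_eq_0_iff)
    then have "r = s" using undom[OF r(1)] by auto
    then show False using 0 \<open>0 < q\<close> by simp
  qed
  then have "0 < ?h r" using shortfall_nonneg[of s r] by linarith
  moreover have "?h r \<le> gauge_fun K s q"
    unfolding gauge_fun_def by (rule cINF_greatest[OF ne r(2)])
  ultimately show ?thesis by linarith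
qed

text \<open>The factor \<open>1 - exp (- q)\<close> makes the gauge strictly increasing and pushes it strictly below
  the shortfall, so that on \<open>K\<close> no excess compensates a shortfall.\<close>

lemma exists_strictly_increasing_unique_maximum:
  fixes K :: "(real ^ 'n::finite) set"
  assumes K: "compact K" and s: "s \<in> K" and undom: "\<And>r. r \<in> K \<Longrightarrow> \<not> s < r"
  obtains V where "continuous_on UNIV V" "strictly_increasing V"
    "\<And>r. r \<in> K \<Longrightarrow> r \<noteq> s \<Longrightarrow> V r < V s"
proof
  have ne: "K \<noteq> {}" using s by auto
  define \<psi> where "\<psi> q = gauge_fun K s q * (1 - exp (- q))" for q
  define V where "V x = \<psi> (excess s x) - shortfall s x" for x
  have \<psi>_cont: "continuous_on UNIV \<psi>"
    unfolding \<psi>_def by (intro continuous_intros continuous_on_gauge_fun ne)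
  have \<psi>_less: "\<psi> a < \<psi> b" if "0 \<le> a" "a < b" for a b
  proof -
    \<comment> \<open>The gauge is only weakly increasing; strictness comes from the exponential
      factor, because the gauge is positive at \<open>b > 0\<close>.\<close>
    have "\<psi> a \<le> gauge_fun K s b * (1 - exp (- a))"
      unfolding \<psi>_def using that by (intro mult_right_mono gauge_fun_mono ne) auto
    also have "\<dots> < \<psi> b"
      unfolding \<psi>_def using that by (intro mult_strict_left_mono gauge_fun_pos K s undom) auto
    finally show ?thesis .
  qed
  show "continuous_on UNIV V"
    unfolding V_def
    by (intro continuous_intros continuous_on_compose2[OF \<psi>_cont]) auto
  show "strictly_increasing V"
    unfolding strictly_increasing_def
  proof (intro allI strict_monoI)
    fix x :: "real ^ 'n" and i and t u :: real
    assume tu: "t < u"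
    let ?t = "\<chi> j. if j = i then t else x $ j" and ?u = "\<chi> j. if j = i then u else x $ j"
    have split: "sum h UNIV = h i + sum h (UNIV - {i})" for h :: "'n \<Rightarrow> real"
      by (simp add: sum.remove)
    have P: "shortfall s ?t - shortfall s ?u = max 0 (s $ i - t) - max 0 (s $ i - u)"
      by (simp add: shortfall_def split)
    have Q: "excess s ?u - excess s ?t = max 0 (u - s $ i) - max 0 (t - s $ i)"
      by (simp add: shortfall_def split)
    \<comment> \<open>A move ending above \<open>s $ i\<close> strictly raises the excess; one
      ending at or below it strictly lowers the shortfall and leaves the excess alone.\<close>
    show "V ?t < V ?u"
    proof (cases "s $ i < u")
      case True
      then have "excess s ?t < excess s ?u" using Q tu by linarith
      then have "\<psi> (excess s ?t) < \<psi> (excess s ?u)" by (rule \<psi>_less[OF shortfall_nonneg])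
      moreover have "shortfall s ?u \<le> shortfall s ?t" using P tu by linarith
      ultimately show ?thesis unfolding V_def by linarith
    next
      case False
      then have "excess s ?t = excess s ?u" using Q tu by linarith
      moreover have "shortfall s ?u < shortfall s ?t" using False P tu by linarith
      ultimately show ?thesis unfolding V_def by simp
    qed
  qed
  fix r assume r: "r \<in> K" "r \<noteq> s"
  have "V s = 0" by (simp add: V_def \<psi>_def)
  have pos: "0 < shortfall s r"
    using r undom[OF r(1)] shortfall_nonneg[of s r] shortfall_eq_0_iff[of s r]
    by (metis order_le_less)
  \<comment> \<open>The factor below 1 gives strictness only for a nonzero gauge; for a zero gauge
    \<open>pos\<close> supplies it.\<close>
  have "\<psi> (excess s r) < shortfall s r"
  proof (cases "gauge_fun K s (excess s r) = 0")
    case True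
    then show ?thesis using pos by (simp add: \<psi>_def)
  next
    case False
    then have "0 < gauge_fun K s (excess s r)"
      using gauge_fun_nonneg[OF ne] by (simp add: less_le)
    then have "\<psi> (excess s r) < gauge_fun K s (excess s r)"
      by (simp add: \<psi>_def algebra_simps)
    also have "\<dots> \<le> shortfall s r" using gauge_fun_le[OF r(1), of s "excess s r"] by simp
    finally show ?thesis .
  qed
  then show "V r < V s" using \<open>V s = 0\<close> by (simp add: V_def)
qed

section \<open>Maximizing sequences and optimizers made of point masses\<close>

lemma exists_ge_expectation:
  fixes g :: "'a \<Rightarrow> real"
  assumes p: "p \<in> space (prob_algebra M)" and g: "g \<in> borel_measurable M"
    and bd: "bounded (g ` space M)"
  shows "\<exists>y\<in>space M. (\<integral>x. g x \<partial>p) \<le> g y"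
proof (rule ccontr)
  assume "\<not> ?thesis"
  then have less: "\<And>y. y \<in> space M \<Longrightarrow> g y < (\<integral>x. g x \<partial>p)" by force
  have sets: "sets p = sets M" and "prob_space p"
    using p by (auto simp: space_prob_algebra)
  interpret prob_space p by fact
  have sp: "space p = space M" by (rule sets_eq_imp_space_eq[OF sets])
  obtain B where B: "\<And>x. x \<in> space M \<Longrightarrow> \<bar>g x\<bar> \<le> B"
    using bd by (auto simp: bounded_iff)
  have "g \<in> borel_measurable p" using g sets by (simp cong: measurable_cong_sets)
  then have int: "integrable p g"
    using B sp by (intro integrable_const_bound[where B = B]) (auto intro!: AE_I2)
  have "(\<integral>x. g x \<partial>p) < (\<integral>x. g x \<partial>p)"
    using expectation_less[OF int, of "\<integral>x. g x \<partial>p"] less sp by (auto intro!: AE_I2)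
  then show False by simp
qed

text \<open>The condition on \<open>y 0\<close> covers the step from the prior, which an optimizer
  must return at \<open>k = 0\<close>, to the point masses used for \<open>k > 0\<close>.\<close>

definition maximizing_seq ::
    "'a measure \<Rightarrow> ('a \<Rightarrow> real) \<Rightarrow> 'a measure \<Rightarrow> (nat \<Rightarrow> 'a) \<Rightarrow> bool" where
  "maximizing_seq M g p y \<longleftrightarrow> range y \<subseteq> space M \<and> (\<integral>x. g x \<partial>p) \<le> g (y 0) \<and>
     incseq (\<lambda>n. g (y n)) \<and> (\<lambda>n. g (y n)) \<longlonglongrightarrow> (SUP x\<in>space M. g x)"

text \<open>Confinement to \<open>A\<close> later keeps \<open>f\<close> large along the sequence,
  at no cost to the supremum of \<open>g\<close>.\<close>

lemma exists_maximizing_seq_in: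
  assumes bd: "bounded (g ` space M)" and A: "A \<subseteq> space M"
    and sup: "\<And>m. m < (SUP x\<in>space M. g x) \<Longrightarrow> \<exists>y\<in>A. m < g y"
    and a: "a \<in> A" "(\<integral>x. g x \<partial>p) \<le> g a"
  shows "\<exists>y. range y \<subseteq> A \<and> maximizing_seq M g p y"
proof -
  let ?G = "SUP x\<in>space M. g x"
  have bdd: "bdd_above (g ` space M)" using bd by (rule bounded_imp_bdd_above)
  have le: "g x \<le> ?G" if "x \<in> A" for x
    using that A by (intro cSUP_upper[OF _ bdd]) auto
  \<comment> \<open>The bound at stage \<open>n\<close> concerns \<open>y (Suc n)\<close>, so the
    start \<open>y 0 = a\<close> is exempt from it.\<close>
  have "\<exists>y. \<forall>n. (y n \<in> A \<and> (n = 0 \<longrightarrow> y n = a)) \<and>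
      (g (y n) \<le> g (y (Suc n)) \<and> ?G - 1 / Suc n \<le> g (y (Suc n)))"
  proof (rule dependent_nat_choice)
    show "\<exists>x. x \<in> A \<and> (0 = (0::nat) \<longrightarrow> x = a)" using a by auto
    fix x n assume x: "x \<in> A \<and> (n = (0::nat) \<longrightarrow> x = a)"
    obtain z where z: "z \<in> A" "?G - 1 / Suc n < g z" using sup[of "?G - 1 / Suc n"] by auto
    \<comment> \<open>Keeping the better of the old point and the new near-maximizer gives both
      monotonicity and approach to the supremum.\<close>
    show "\<exists>z. (z \<in> A \<and> (Suc n = 0 \<longrightarrow> z = a)) \<and> (g x \<le> g z \<and> ?G - 1 / Suc n \<le> g z)"
    proof (cases "g x \<le> g z")
      case True then show ?thesis using z by (intro exI[of _ z]) auto
    next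
      case False then show ?thesis using x z by (intro exI[of _ x]) auto
    qed
  qed
  then obtain y where y: "\<And>n. y n \<in> A" "y 0 = a" "\<And>n. g (y n) \<le> g (y (Suc n))"
      "\<And>n. ?G - 1 / Suc n \<le> g (y (Suc n))"
    by metis
  have "(\<lambda>n. ?G - 1 / Suc n) \<longlonglongrightarrow> ?G - 0"
    by (rule tendsto_diff[OF tendsto_const LIMSEQ_Suc[OF lim_1_over_n]])
  then have "(\<lambda>n. ?G - 1 / Suc n) \<longlonglongrightarrow> ?G" by simp
  then have "(\<lambda>n. g (y (Suc n))) \<longlonglongrightarrow> ?G"
    by (rule tendsto_sandwich[OF _ _ _ tendsto_const, rotated 2])
      (simp_all only: y(4) le[OF y(1)] eventually_True)
  then have "(\<lambda>n. g (y n)) \<longlonglongrightarrow> ?G" by (rule LIMSEQ_imp_Suc)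
  then have "maximizing_seq M g p y"
    using y a A by (auto simp: maximizing_seq_def intro!: incseq_SucI)
  then show ?thesis using y(1) by blast
qed

lemma exists_maximizing_seq:
  assumes "space M \<noteq> {}" "g \<in> bounded_measurable M" "p \<in> space (prob_algebra M)"
  shows "\<exists>y. maximizing_seq M g p y"
proof -
  have g: "g \<in> borel_measurable M" "bounded (g ` space M)"
    using assms(2) by (auto simp: bounded_measurable_def)
  have "\<exists>y\<in>space M. m < g y" if "m < (SUP x\<in>space M. g x)" for m
    using that less_cSUP_iff[OF assms(1) bounded_imp_bdd_above[OF g(2)]] by auto
  moreover obtain a where "a \<in> space M" "(\<integral>x. g x \<partial>p) \<le> g a"
    using exists_ge_expectation[OF assms(3) g] by auto
  ultimately show ?thesis
    using exists_maximizing_seq_in[OF g(2) subset_refl] by blast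
qed

lemma filterlim_nat_ceiling: "filterlim (\<lambda>k::real. nat \<lceil>k\<rceil>) sequentially at_top"
  unfolding filterlim_at_top
proof
  fix N :: nat
  show "\<forall>\<^sub>F k::real in at_top. N \<le> nat \<lceil>k\<rceil>"
    using eventually_ge_at_top[of "real N"] by eventually_elim linarith
qed

text \<open>Under a point mass the mean of \<open>g\<close> is its value there, so the axioms become
  statements about \<open>g (Y g p n)\<close>; the ceiling turns real \<open>k\<close> into a
  nondecreasing index.\<close>

lemma optimizer_of_maximizing_seqs:
  assumes Y: "\<And>g p. g \<in> bounded_measurable M \<Longrightarrow> p \<in> space (prob_algebra M) \<Longrightarrow>
      maximizing_seq M g p (Y g p)"
  shows "optimizer M (\<lambda>k g p. if k = 0 then p else return M (Y g p (nat \<lceil>k\<rceil>)))"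
    (is "optimizer M ?\<Omega>")
  unfolding optimizer_def
proof (intro ballI conjI allI impI; (elim conjE)?)
  fix g p assume gM: "g \<in> bounded_measurable M" and p: "p \<in> space (prob_algebra M)"
  let ?y = "Y g p" and ?G = "SUP x\<in>space M. g x"
  have g: "g \<in> borel_measurable M" using gM by (auto simp: bounded_measurable_def)
  have y: "?y n \<in> space M" "(\<integral>x. g x \<partial>p) \<le> g (?y 0)" "incseq (\<lambda>n. g (?y n))"
      "(\<lambda>n. g (?y n)) \<longlonglongrightarrow> ?G" for n
    using Y[OF gM p] by (auto simp: maximizing_seq_def)
  have E: "(\<integral>x. g x \<partial>?\<Omega> k g p) = g (?y (nat \<lceil>k\<rceil>))" if "k \<noteq> 0" for k
    using that by (simp add: integral_return y(1) g)
  have lim: "((\<lambda>k::real. g (?y (nat \<lceil>k\<rceil>))) \<longlongrightarrow> ?G) at_top"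
    by (rule filterlim_compose[OF y(4) filterlim_nat_ceiling])
  have pos: "\<forall>\<^sub>F k::real in at_top. k \<noteq> 0"
    using eventually_gt_at_top[of 0] by eventually_elim auto
  show "?\<Omega> k g p \<in> space (prob_algebra M)" for k
    using p y(1) by (auto simp: space_prob_algebra prob_space_return)
  show "?\<Omega> 0 g p = p" by simp
  show "(\<integral>x. g x \<partial>?\<Omega> j g p) \<le> (\<integral>x. g x \<partial>?\<Omega> k g p)" if "0 \<le> j" "j < k" for j k
  proof -
    have "g (?y (nat \<lceil>j\<rceil>)) \<le> g (?y (nat \<lceil>k\<rceil>))"
      using that by (intro incseqD[OF y(3)] nat_mono ceiling_mono) auto
    moreover have "g (?y 0) \<le> g (?y (nat \<lceil>k\<rceil>))" by (intro incseqD[OF y(3)]) auto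
    \<comment> \<open>For \<open>j = 0\<close> the left side is the mean under the prior, bounded by
      \<open>g (?y 0)\<close>.\<close>
    ultimately show ?thesis
      using y(2) E[of j] E[of k] that by (cases "j = 0") auto
  qed
  show "((\<lambda>k. measure (?\<Omega> k g p) {x \<in> space M. m < g x}) \<longlongrightarrow> 1) at_top"
    if "m < ?G" for m
  \<comment> \<open>Once \<open>g\<close> exceeds \<open>m\<close> at the current point, the
    probability is exactly 1.\<close>
  proof (rule tendsto_eventually)
    have meas: "{x \<in> space M. m < g x} \<in> sets M" using g by measurable
    show "\<forall>\<^sub>F k in at_top. measure (?\<Omega> k g p) {x \<in> space M. m < g x} = 1"
      using order_tendstoD(1)[OF lim that] pos
      by eventually_elim (simp add: measure_return meas y(1))
  qed
  show "((\<lambda>k. \<integral>x. g x \<partial>?\<Omega> k g p) \<longlongrightarrow> ?G) at_top"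
    by (rule Lim_transform_eventually[OF lim], rule eventually_mono[OF pos]) (use E in auto)
qed

text \<open>An optimizer must treat all objectives and priors, so arbitrary maximizing sequences are
  chosen away from the pair \<open>g\<close>, \<open>p\<close>.\<close>

lemma exists_optimizer_along_seq:
  assumes "space M \<noteq> {}" and y: "maximizing_seq M g p y"
  obtains \<Omega> where "optimizer M \<Omega>" "\<And>k. 0 < k \<Longrightarrow> \<Omega> k g p = return M (y (nat \<lceil>k\<rceil>))"
proof -
  define Y where "Y g' p' =
    (if g' = g \<and> p' = p then y else (SOME z. maximizing_seq M g' p' z))" for g' p'
  have "maximizing_seq M g' p' (Y g' p')"
    if "g' \<in> bounded_measurable M" "p' \<in> space (prob_algebra M)" for g' p'
    using y someI_ex[OF exists_maximizing_seq[OF assms(1) that]] by (auto simp: Y_def)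
  from optimizer_of_maximizing_seqs[of M Y, OF this]
  show ?thesis by (rule that) (auto simp: Y_def)
qed

section \<open>Catastrophic proxies from undominated points\<close>

lemma Limsup_expectation_le:
  fixes f g :: "'a \<Rightarrow> real"
  assumes \<Omega>: "optimizer M \<Omega>" and gM: "g \<in> bounded_measurable M"
    and p: "p \<in> space (prob_algebra M)"
    and f: "f \<in> borel_measurable M" "bounded (f ` space M)"
    and m: "m < (SUP y\<in>space M. g y)"
    and le: "\<And>x. x \<in> space M \<Longrightarrow> m < g x \<Longrightarrow> f x \<le> c"
  shows "Limsup at_top (\<lambda>k::real. ereal (\<integral>x. f x \<partial>\<Omega> k g p)) \<le> ereal c"
proof -
  let ?A = "{x \<in> space M. m < g x}"
  obtain B where B: "\<And>x. x \<in> space M \<Longrightarrow> \<bar>f x\<bar> \<le> B"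
    using f(2) by (auto simp: bounded_iff)
  \<comment> \<open>This makes \<open>c + C\<close> at least \<open>B\<close>, an upper bound for
    \<open>f\<close> off \<open>?A\<close>; the mass there tends to 0.\<close>
  define C where "C = \<bar>B\<bar> + \<bar>c\<bar>"
  have "g \<in> borel_measurable M" using gM by (simp add: bounded_measurable_def)
  then have A: "?A \<in> sets M" by measurable
  have lim: "((\<lambda>k. measure (\<Omega> k g p) ?A) \<longlongrightarrow> 1) at_top"
    using \<Omega> gM p m by (auto simp: optimizer_def)
  have bound: "(\<integral>x. f x \<partial>\<Omega> k g p) \<le> c + C * (1 - measure (\<Omega> k g p) ?A)" if "0 \<le> k" for k
  proof -
    let ?N = "\<Omega> k g p"
    have "?N \<in> space (prob_algebra M)" using \<Omega> gM p that by (auto simp: optimizer_def)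
    then have sets: "sets ?N = sets M" and "prob_space ?N" by (auto simp: space_prob_algebra)
    interpret prob_space ?N by fact
    have sp: "space ?N = space M" by (rule sets_eq_imp_space_eq[OF sets])
    have A': "?A \<in> sets ?N" using A sets by simp
    have "f \<in> borel_measurable ?N" using f(1) sets by (simp cong: measurable_cong_sets)
    then have int: "integrable ?N f"
      using B sp by (intro integrable_const_bound[where B = B]) (auto intro!: AE_I2)
    have intA: "integrable ?N (indicator ?A :: 'a \<Rightarrow> real)"
      using A' by (intro integrable_const_bound[where B = 1]) (auto simp: indicator_def)
    have "(\<integral>x. f x \<partial>?N) \<le> (\<integral>x. c + C * (1 - indicator ?A x) \<partial>?N)"
    proof (intro integral_mono int)
      show "integrable ?N (\<lambda>x. c + C * (1 - indicator ?A x))" using intA by simp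
      fix x assume x: "x \<in> space ?N"
      show "f x \<le> c + C * (1 - indicator ?A x)"
        using le[of x] B[of x] x sp by (cases "x \<in> ?A") (auto simp: C_def)
    qed
    also have "\<dots> = c + C * (1 - measure ?N ?A)"
      using intA A' sp by (simp add: prob_space[unfolded sp] Int_absorb2)
    finally show ?thesis .
  qed
  have "((\<lambda>k. c + C * (1 - measure (\<Omega> k g p) ?A)) \<longlongrightarrow> c + C * (1 - 1)) at_top"
    by (intro tendsto_intros lim)
  then have lim': "((\<lambda>k. ereal (c + C * (1 - measure (\<Omega> k g p) ?A))) \<longlongrightarrow> ereal c) at_top"
    by simp
  have "Limsup at_top (\<lambda>k::real. ereal (\<integral>x. f x \<partial>\<Omega> k g p))
      \<le> Limsup at_top (\<lambda>k. ereal (c + C * (1 - measure (\<Omega> k g p) ?A)))"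
    by (rule Limsup_mono, rule eventually_mono[OF eventually_ge_at_top[of 0]]) (simp add: bound)
  also have "\<dots> = ereal c"
    by (rule lim_imp_Limsup[OF trivial_limit_at_top_linorder lim'])
  finally show ?thesis .
qed

lemma continuous_on_compose_bounded_measurable:
  fixes L :: "'a \<Rightarrow> real ^ 'n::finite" and V :: "real ^ 'n \<Rightarrow> real"
  assumes "continuous_on UNIV V" "L \<in> borel_measurable M" "bounded (L ` space M)"
  shows "restrict (\<lambda>x. V (L x)) (space M) \<in> bounded_measurable M"
proof -
  have "compact (V ` closure (L ` space M))"
    using assms by (intro compact_continuous_image continuous_on_subset[OF assms(1)]) auto
  then have "bounded (V ` closure (L ` space M))" by (rule compact_imp_bounded)
  then have "bounded ((\<lambda>x. V (L x)) ` space M)"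
    by (rule bounded_subset) (use closure_subset in blast)
  moreover have "(\<lambda>x. V (L x)) \<in> borel_measurable M"
    by (rule borel_measurable_continuous_on[OF assms(1,2)])
  ultimately show ?thesis
    by (simp add: bounded_measurable_def cong: measurable_cong image_cong_simp)
qed

text \<open>Open conditions at a limit point, which need not be a value of \<open>L\<close>, are
  realized at a point of \<open>A\<close>.\<close>

lemma closure_image_meets_open:
  assumes "s \<in> closure (L ` A)" "open T" "s \<in> T"
  shows "\<exists>x\<in>A. L x \<in> T"
  using assms open_Int_closure_eq_empty[of T "L ` A"] by blast

lemma catastrophic_of_undominated:
  fixes L :: "'a \<Rightarrow> real ^ 'n::finite" and U :: "real ^ 'n \<Rightarrow> real"
  assumes L: "L \<in> borel_measurable M" "bounded (L ` space M)"
    and U: "continuous_on UNIV U" and f: "\<And>x. x \<in> space M \<Longrightarrow> f x = U (L x)"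
    and s: "s \<in> undominated (L ` space M)" "U s \<le> \<eta>"
  shows "\<exists>g. tradeoff_proxy M L g \<and> catastrophic M f \<eta> g"
proof -
  let ?K = "closure (L ` space M)"
  have K: "compact ?K" using L(2) by simp
  have sK: "s \<in> ?K" "\<And>r. r \<in> ?K \<Longrightarrow> \<not> s < r" using s(1) by (auto simp: undominated_def)
  obtain V where V: "continuous_on UNIV V" "strictly_increasing V"
    and Vmax: "\<And>r. r \<in> ?K \<Longrightarrow> r \<noteq> s \<Longrightarrow> V r < V s"
    using exists_strictly_increasing_unique_maximum[OF K sK] by blast
  define g where "g = restrict (\<lambda>x. V (L x)) (space M)"
  have gM: "g \<in> bounded_measurable M"
    unfolding g_def by (rule continuous_on_compose_bounded_measurable[OF V(1) L])
  \<comment> \<open>\<open>f\<close> need not be extensional; its measurability and boundedness are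
    read off from this restriction, with which it agrees on \<open>space M\<close>.\<close>
  have "restrict (\<lambda>x. U (L x)) (space M) \<in> bounded_measurable M"
    by (rule continuous_on_compose_bounded_measurable[OF U L])
  then have fM: "f \<in> borel_measurable M" "bounded (f ` space M)"
    using f by (auto simp: bounded_measurable_def cong: measurable_cong image_cong_simp)
  have Ksub: "L x \<in> ?K" if "x \<in> space M" for x
    using that by (intro subsetD[OF closure_subset]) auto
  have "Limsup at_top (\<lambda>k::real. ereal (\<integral>x. f x \<partial>\<Omega> k g p)) \<le> ereal \<eta>"
    if p: "p \<in> space (prob_algebra M)" and \<Omega>: "optimizer M \<Omega>" for p \<Omega>
  proof (rule ereal_le_epsilon2)
    fix e :: real assume "0 < e"
    \<comment> \<open>The compact set \<open>?F\<close> misses \<open>s\<close>, as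
      \<open>U s \<le> \<eta>\<close>, so \<open>V\<close> is bounded on it by some
      \<open>m < V s\<close>. Where \<open>g\<close> exceeds \<open>m\<close>, \<open>L x\<close>
      lies outside \<open>?F\<close>.\<close>
    let ?F = "?K \<inter> {r. \<eta> + e \<le> U r}"
    have "closed {r. \<eta> + e \<le> U r}"
      by (rule closed_Collect_le[OF continuous_on_const U])
    then have F: "compact ?F" using K by blast
    obtain m where m: "m < V s" "\<And>r. r \<in> ?F \<Longrightarrow> V r \<le> m"
    proof (cases "?F = {}")
      case True
      then show ?thesis using that[of "V s - 1"] by auto
    next
      case False
      then obtain r where r: "r \<in> ?F" "\<And>z. z \<in> ?F \<Longrightarrow> V z \<le> V r"
        using continuous_attains_sup[OF F False continuous_on_subset[OF V(1)]] by auto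
      then have "r \<noteq> s" using s(2) \<open>0 < e\<close> by auto
      then show ?thesis using that[of "V r"] r Vmax by auto
    qed
    have "open {r. m < V r}" by (rule open_Collect_less[OF continuous_on_const V(1)])
    from closure_image_meets_open[OF sK(1) this] m(1)
    obtain x where x: "x \<in> space M" "m < g x" by (auto simp: g_def)
    have "g x \<le> (SUP y\<in>space M. g y)"
      using gM x by (intro cSUP_upper bounded_imp_bdd_above) (auto simp: bounded_measurable_def)
    then have msup: "m < (SUP y\<in>space M. g y)" using x by simp
    have "f x \<le> \<eta> + e" if "x \<in> space M" "m < g x" for x
      using m(2)[of "L x"] that Ksub f by (force simp: g_def)
    from Limsup_expectation_le[OF \<Omega> gM p fM msup this]
    show "Limsup at_top (\<lambda>k::real. ereal (\<integral>x. f x \<partial>\<Omega> k g p)) \<le> ereal \<eta> + ereal e" by simp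
  qed
  then have "catastrophic M f \<eta> g" using gM by (auto simp: catastrophic_def)
  moreover have "tradeoff_proxy M L g" using V by (auto simp: tradeoff_proxy_def g_def)
  ultimately show ?thesis by blast
qed

section \<open>Undominated points from catastrophic proxies\<close>

lemma undominated_of_catastrophic:
  fixes L :: "'a \<Rightarrow> real ^ 'n::finite" and U :: "real ^ 'n \<Rightarrow> real"
  assumes ne: "space M \<noteq> {}" and L: "L \<in> borel_measurable M" "bounded (L ` space M)"
    and U: "continuous_on UNIV U" and f: "\<And>x. x \<in> space M \<Longrightarrow> f x = U (L x)"
    and g: "tradeoff_proxy M L g" "catastrophic M f \<eta> g"
  shows "\<exists>s\<in>undominated (L ` space M). U s \<le> \<eta>"
proof -
  let ?K = "closure (L ` space M)" and ?G = "SUP x\<in>space M. g x"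
  have K: "compact ?K" "?K \<noteq> {}" using L(2) ne by auto
  obtain V where V: "continuous_on UNIV V" "strictly_increasing V"
    and gV: "\<And>x. x \<in> space M \<Longrightarrow> g x = V (L x)"
    using g(1) by (auto simp: tradeoff_proxy_def)
  have gM: "g \<in> borel_measurable M" "bounded (g ` space M)"
    using g(2) by (auto simp: catastrophic_def bounded_measurable_def)
  have "(\<lambda>x. U (L x)) \<in> borel_measurable M"
    by (rule borel_measurable_continuous_on[OF U L(1)])
  then have fM: "f \<in> borel_measurable M" using f by (simp cong: measurable_cong)
  obtain s where s: "s \<in> ?K" "\<And>r. r \<in> ?K \<Longrightarrow> V r \<le> V s"
    using continuous_attains_sup[OF K continuous_on_subset[OF V(1)]] by auto
  have "s \<in> undominated (L ` space M)"
    using s strictly_increasing_strict_mono[OF V(2)] by (force simp: undominated_def)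
  moreover have "U s \<le> \<eta>"
  proof (rule ccontr)
    assume "\<not> U s \<le> \<eta>"
    \<comment> \<open>The gap between \<open>\<eta>\<close> and \<open>c\<close> keeps the upper
      limit strictly above \<open>\<eta>\<close>.\<close>
    then obtain c where c: "\<eta> < c" "c < U s" using dense[of \<eta> "U s"] by auto
    define A where "A = {x \<in> space M. c < f x}"
    have Gle: "?G \<le> V s"
    proof (rule cSUP_least[OF ne])
      fix x assume "x \<in> space M"
      then have "L x \<in> ?K" by (intro subsetD[OF closure_subset]) auto
      then show "g x \<le> V s" using s(2) gV \<open>x \<in> space M\<close> by simp
    qed
    \<comment> \<open>Both \<open>V > m\<close> and \<open>U > c\<close> are open conditions
      satisfied at \<open>s\<close>, so one point of the space meets both.\<close>
    have sup: "\<exists>y\<in>A. m < g y" if "m < ?G" for m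
    proof -
      have "open {r. m < V r \<and> c < U r}"
        by (intro open_Collect_conj open_Collect_less[OF continuous_on_const V(1)]
            open_Collect_less[OF continuous_on_const U])
      from closure_image_meets_open[OF s(1) this] that Gle c
      obtain x where "x \<in> space M" "m < V (L x)" "c < U (L x)" by auto
      then show ?thesis using f gV by (auto simp: A_def)
    qed
    obtain a where a: "a \<in> A" using sup[of "?G - 1"] by auto
    then have aM: "a \<in> space M" by (simp add: A_def)
    \<comment> \<open>A prior concentrated at a point of \<open>A\<close> lets the maximizing
      sequence start inside \<open>A\<close>.\<close>
    define p where "p = return M a"
    have p: "p \<in> space (prob_algebra M)"
      using aM by (auto simp: p_def space_prob_algebra prob_space_return)
    have "(\<integral>x. g x \<partial>p) \<le> g a" by (simp add: p_def integral_return aM gM)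
    moreover have "A \<subseteq> space M" by (auto simp: A_def)
    ultimately obtain y where y: "range y \<subseteq> A" "maximizing_seq M g p y"
      using exists_maximizing_seq_in[OF gM(2) _ sup a] by blast
    obtain \<Omega> where \<Omega>: "optimizer M \<Omega>" "\<And>k. 0 < k \<Longrightarrow> \<Omega> k g p = return M (y (nat \<lceil>k\<rceil>))"
      using exists_optimizer_along_seq[OF ne y(2)] by blast
    have yA: "y n \<in> space M" "c < f (y n)" for n using y(1) by (auto simp: A_def)
    have "\<forall>\<^sub>F k::real in at_top. ereal c \<le> ereal (\<integral>x. f x \<partial>\<Omega> k g p)"
      using eventually_gt_at_top[of 0]
      by eventually_elim (simp add: \<Omega>(2) integral_return yA(1) fM less_imp_le[OF yA(2)])
    then have "ereal c \<le> Limsup at_top (\<lambda>k::real. ereal (\<integral>x. f x \<partial>\<Omega> k g p))"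
      by (intro le_Limsup trivial_limit_at_top_linorder)
    also have "\<dots> \<le> ereal \<eta>" using g(2) p \<Omega>(1) by (auto simp: catastrophic_def)
    finally show False using c by simp
  qed
  ultimately show ?thesis by blast
qed

theorem theorem6p1:
  fixes M :: "'a measure"
    and L :: "'n::finite \<Rightarrow> 'a \<Rightarrow> real"
    and Lvec :: "'a \<Rightarrow> real ^ 'n"
    and S :: "(real ^ 'n) set"
    and U :: "real ^ 'n \<Rightarrow> real"
    and f :: "'a \<Rightarrow> real"
    and \<eta> :: real
  assumes "standard_borel_space M"
    and "space M \<noteq> {}"
    and "\<And>i. L i \<in> borel_measurable M"
    and "\<And>x. x \<in> space M \<Longrightarrow> Lvec x = (\<chi> i. L i x)"
    and "S = Lvec ` space M"
    and "continuous_on UNIV U"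
    and "strictly_increasing U"
    and "\<And>x. x \<in> space M \<Longrightarrow> f x = U (Lvec x)"
    and "bounded S"
    and "(INF y\<in>space M. f y) \<le> \<eta>"
    and "\<eta> < (SUP y\<in>space M. f y)"
  shows "(\<exists>g. tradeoff_proxy M Lvec g \<and> catastrophic M f \<eta> g) \<longleftrightarrow>
         (\<exists>s\<in>undominated S. U s \<le> \<eta>)"
proof -
  have "Lvec \<in> borel_measurable M"
  proof (rule borel_measurable_euclidean_space[THEN iffD2], intro ballI)
    fix b :: "real ^ 'n" assume "b \<in> Basis"
    \<comment> \<open>Pairing with the unit vector \<open>axis i 1\<close> recovers
      \<open>L i\<close>.\<close>
    then obtain i where "b = axis i 1" by (auto simp: Basis_vec_def)
    then show "(\<lambda>x. Lvec x \<bullet> b) \<in> borel_measurable M"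
      using assms(3)[of i] assms(4) by (simp add: inner_axis cong: measurable_cong)
  qed
  moreover have "bounded (Lvec ` space M)" using assms by simp
  ultimately show ?thesis
    using catastrophic_of_undominated[of Lvec M U f _ \<eta>]
      undominated_of_catastrophic[OF assms(2), of Lvec U f _ \<eta>] assms(5,6,8)
    by blast
qed

end
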